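(* Let $r\ge 1$ be an integer and let $\mathbf z=(z_1,\dots,z_r)\in(\mathbb C^\times)^r$. For every non-negative integer $m$ the following identities hold. (1) $$\sum_{k=\max\left(\lfloor m/2\rfloor-r,\,0\right)}^{\lfloor m/2\rfloor} c_{m-r-1,k}\, e^{(2r)}_{m-2k}(\mathbf z,\mathbf z^{-1})=\begin{cases} e^{(r)}_m(\mathbf z+\mathbf z^{-1}) & (m=0,1,\dots,r)\\ 0 & (\text{otherwise, i.e. } m>r).\end{cases}$$ (2) $$h^{(r)}_m(\mathbf z+\mathbf z^{-1})=\sum_{k=0}^{\lfloor m/2\rfloor} c_{m+r-1,k}\,h^{(2r)}_{m-2k}(\mathbf z,\mathbf z^{-1}).$$ (3) $$p^{(r)}_m(\mathbf z+\mathbf z^{-1})=\frac12\sum_{k=0}^{m}\binom mk\, p^{(2r)}_{|m-2k|}(\mathbf z,\mathbf z^{-1}).$$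
   Context: For $s\ge1$, $n\ge0$ and $\mathbf w=(w_1,\dots,w_s)\in\mathbb C^s$: $e^{(s)}_n(\mathbf w)=\sum_{1\le j_1<\dots<j_n\le s}w_{j_1}\cdots w_{j_n}$ for $1\le n\le s$, $e_0^{(s)}=1$, $e^{(s)}_n=0$ for $n>s$ (elementary symmetric); $h^{(s)}_n(\mathbf w)=\sum_{m_1+\dots+m_s=n}w_1^{m_1}\cdots w_s^{m_s}$ over non-negative integers $m_i$ (complete homogeneous); $p^{(s)}_n(\mathbf w)=\sum_{j=1}^s w_j^n$ (power sum, so $p_0^{(s)}=s$). For $\mathbf z\in(\mathbb C^\times)^r$: $\mathbf z+\mathbf z^{-1}:=(z_1+z_1^{-1},\dots,z_r+z_r^{-1})\in\mathbb C^r$ and $(\mathbf z,\mathbf z^{-1}):=(z_1,\dots,z_r,z_1^{-1},\dots,z_r^{-1})\in\mathbb C^{2r}$. For an integer $n$ (possibly negative), $\binom nk=\frac{n(n-1)\cdots(n-k+1)}{k!}$ for $k\ge1$, $\binom n0=1$, and $\binom nk=0$ for $k<0$. Put $c_{n,k}:=\binom nk-\binom n{k-1}$. $\lfloor x\rfloor$ is the greatest integer not exceeding $x$. *)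

theory Defs
  imports Complex_Main "HOL-Library.FuncSet"
begin

text \<open>
  A vector in \<open>\<complex>\<^sup>s\<close> is a function \<open>w :: nat \<Rightarrow> complex\<close> together with its dimension \<open>s\<close>;
  only the components \<open>w 1, \<dots>, w s\<close> are ever used.
\<close>

text \<open>
  The index tuples \<open>1 \<le> j\<^sub>1 < \<dots> < j\<^sub>n \<le> s\<close> are represented by the \<open>n\<close>-element subsets of
  \<open>{1..s}\<close>. The conventions \<open>e\<^sub>0 = 1\<close> and \<open>e\<^sub>n = 0\<close> for \<open>n > s\<close> are instances of the formula.
\<close>
definition elem_sym :: "nat \<Rightarrow> nat \<Rightarrow> (nat \<Rightarrow> complex) \<Rightarrow> complex" where
  "elem_sym s n w = (\<Sum>J | J \<subseteq> {1..s} \<and> card J = n. \<Prod>j\<in>J. w j)"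

text \<open>The extensional function space makes the set of exponent tuples finite.\<close>
definition complete_sym :: "nat \<Rightarrow> nat \<Rightarrow> (nat \<Rightarrow> complex) \<Rightarrow> complex" where
  "complete_sym s n w =
     (\<Sum>a | a \<in> {1..s} \<rightarrow>\<^sub>E (UNIV :: nat set) \<and> (\<Sum>i=1..s. a i) = n. \<Prod>i=1..s. w i ^ a i)"

definition power_sum :: "nat \<Rightarrow> nat \<Rightarrow> (nat \<Rightarrow> complex) \<Rightarrow> complex" where
  "power_sum s n w = (\<Sum>j=1..s. w j ^ n)"

definition plus_inverse :: "(nat \<Rightarrow> complex) \<Rightarrow> nat \<Rightarrow> complex" where
  "plus_inverse z = (\<lambda>j. z j + inverse (z j))"

definition append_inverse :: "nat \<Rightarrow> (nat \<Rightarrow> complex) \<Rightarrow> nat \<Rightarrow> complex" where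
  "append_inverse r z = (\<lambda>j. if j \<le> r then z j else inverse (z (j - r)))"

definition binom :: "int \<Rightarrow> int \<Rightarrow> complex" where
  "binom n k = (if k < 0 then 0 else of_int n gchoose nat k)"

definition binom_diff :: "int \<Rightarrow> int \<Rightarrow> complex" where
  "binom_diff n k = binom n k - binom n (k - 1)"

end

theory Submission
  imports Defs "HOL-Computational_Algebra.Formal_Power_Series"
begin

text \<open>
  Identity (3) is the binomial expansion of \<open>(x + 1/x)\<^sup>m\<close> added to its mirror image under
  \<open>x \<leftrightarrow> 1/x\<close>.

  Identities (1) and (2) are two instances of one inversion formula. Put \<open>w = z + 1/z\<close>. The
  factorisation
    \<open>(1 + c z t) (1 + c t/z) = 1 + c w t + t\<^sup>2 = (1 + t\<^sup>2) (1 + c w y)\<close>, where \<open>y = t / (1 + t\<^sup>2)\<close>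
  and \<open>c = \<plusminus>1\<close>, shows that the generating function in \<open>t\<close> of the symmetric functions of
  \<open>(\<^bold>z, \<^bold>z\<^sup>-\<^sup>1)\<close> is the generating function of those of \<open>\<^bold>w\<close> in the variable \<open>y\<close>, times
  \<open>(1 + t\<^sup>2)\<^sup>\<alpha>\<close>. Here \<open>\<alpha> = r\<close> for the elementary functions (\<open>c = 1\<close>, the product itself) and
  \<open>\<alpha> = -r\<close> for the complete ones (\<open>c = -1\<close>, the inverse of the product). As
  \<open>y\<^sup>l (1 + t\<^sup>2)\<^sup>\<alpha> = t\<^sup>l (1 + t\<^sup>2)\<^bsup>\<alpha> - l\<^esup>\<close>, comparing coefficients gives
  (\<open>joukowski_subst_nth\<close>)
    \<open>b\<^sub>n = \<Sum>\<^sub>j binom(\<alpha> - n + 2j, j) a\<^bsub>n - 2j\<^esub>\<close>,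
  which expresses the functions \<open>b\<close> of \<open>(\<^bold>z, \<^bold>z\<^sup>-\<^sup>1)\<close> through the functions \<open>a\<close> of \<open>\<^bold>w\<close>.

  The theorem asserts the inverse relation \<open>a\<^sub>m = \<Sum>\<^sub>k c\<^bsub>m - \<alpha> - 1, k\<^esub> b\<^bsub>m - 2k\<^esub>\<close>
  (\<open>binom_diff_inversion\<close>). Substituting the first relation into it, the coefficient of
  \<open>a\<^bsub>m - 2N\<^esub>\<close> is a Vandermonde convolution in which \<open>\<alpha>\<close> and \<open>m\<close> cancel from the upper
  index: it equals \<open>binom(2N - 1, N) - binom(2N - 1, N - 1)\<close>, which vanishes for \<open>N > 0\<close> by the
  symmetry of row \<open>2N - 1\<close> of the Pascal triangle.
\<close>

section \<open>Inversion of binomial sums\<close>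

text \<open>For \<open>N > 0\<close> the two entries are the equal middle ones of an odd row of the Pascal triangle. For
  \<open>N = 0\<close> the upper index is \<open>-1\<close>, and the single term \<open>binom(-1, 0) = 1\<close> is left.\<close>

lemma binom_middle_diff:
  fixes N :: nat
  shows "((of_int (2 * int N - 1) :: complex) gchoose N)
       - (if N = 0 then 0 else of_int (2 * int N - 1) gchoose (N - 1)) = (if N = 0 then 1 else 0)"
proof (cases "N = 0")
  case False
  then have "(of_int (2 * int N - 1) :: complex) = of_nat (2 * N - 1)"
    by (simp add: of_nat_diff)
  moreover have "(2 * N - 1) choose N = (2 * N - 1) choose (N - 1)"
    using False binomial_symmetric[of N "2 * N - 1"] by simp
  ultimately show ?thesis using False
    by (simp del: of_nat_diff add: binomial_gbinomial[symmetric])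
qed simp

text \<open>The numbers \<open>c\<^bsub>n,k\<^esub>\<close> are the coefficients of \<open>(1 - x) (1 + x)\<^sup>n\<close>, so this is the
  coefficient of \<open>x\<^sup>N\<close> in \<open>(1 - x) (1 + x)\<^bsup>2N - 1\<^esup>\<close>.\<close>
lemma binom_diff_convolution:
  fixes n b :: int and N :: nat
  assumes "n + b = 2 * int N - 1"
  shows "(\<Sum>k\<le>N. binom_diff n (int k) * (of_int b gchoose (N - k))) = (if N = 0 then 1 else 0)"
proof -
  have sum: "(of_int n + of_int b :: complex) = of_int (2 * int N - 1)"
    using assms by (metis of_int_add)
  have "(\<Sum>k\<le>N. binom_diff n (int k) * (of_int b gchoose (N - k)))
      = (\<Sum>k\<le>N. (of_int n gchoose k) * (of_int b gchoose (N - k)))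
      - (\<Sum>k\<le>N. binom n (int k - 1) * (of_int b gchoose (N - k)))"
    by (simp add: binom_diff_def binom_def left_diff_distrib sum_subtractf)
  also have "(\<Sum>k\<le>N. (of_int n gchoose k) * (of_int b gchoose (N - k)))
      = (of_int (2 * int N - 1) :: complex) gchoose N"
    using gbinomial_Vandermonde[of "of_int n :: complex" "of_int b" N]
    by (simp only: sum atLeast0AtMost)
  also have "(\<Sum>k\<le>N. binom n (int k - 1) * (of_int b gchoose (N - k)))
      = (if N = 0 then 0 else of_int (2 * int N - 1) gchoose (N - 1))"
  proof (cases N)
    case 0
    then show ?thesis by (simp add: binom_def)
  next
    case (Suc M)
    have "(\<Sum>k\<le>N. binom n (int k - 1) * (of_int b gchoose (N - k)))
        = (\<Sum>k\<le>M. (of_int n gchoose k) * (of_int b gchoose (M - k)))"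
      unfolding Suc sum.atMost_Suc_shift by (simp add: binom_def)
    also have "\<dots> = (of_int (2 * int N - 1) :: complex) gchoose M"
      using gbinomial_Vandermonde[of "of_int n :: complex" "of_int b" M]
      by (simp only: sum atLeast0AtMost)
    finally show ?thesis using Suc by simp
  qed
  finally show ?thesis by (simp only: binom_middle_diff)
qed

text \<open>Collecting the double sum by \<open>N = k + j\<close> makes the upper indices \<open>m - \<alpha> - 1\<close> and
  \<open>\<alpha> - (m - 2N)\<close> of the inner convolution add up to \<open>2N - 1\<close>, whatever \<open>\<alpha>\<close> and \<open>m\<close> are; only
  \<open>N = 0\<close> survives.\<close>
lemma binom_diff_inversion:
  fixes a b :: "nat \<Rightarrow> complex" and \<alpha> :: int
  assumes b: "\<And>n. b n = (\<Sum>j\<le>n div 2. a (n - 2 * j) * (of_int (\<alpha> - int (n - 2 * j)) gchoose j))"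
  shows "(\<Sum>k\<le>m div 2. binom_diff (int m - \<alpha> - 1) (int k) * b (m - 2 * k)) = a m"
proof -
  let ?c = "\<lambda>k. binom_diff (int m - \<alpha> - 1) (int k)"
  let ?g = "\<lambda>k j. ?c k * (a (m - 2 * (k + j)) * (of_int (\<alpha> - int (m - 2 * (k + j))) gchoose j))"
  have "(\<Sum>k\<le>m div 2. ?c k * b (m - 2 * k)) = (\<Sum>k\<le>m div 2. \<Sum>j\<le>m div 2 - k. ?g k j)"
  proof (rule sum.cong[OF refl])
    fix k assume "k \<in> {..m div 2}"
    moreover have "(m - 2 * k) div 2 = m div 2 - k" by linarith
    ultimately show "?c k * b (m - 2 * k) = (\<Sum>j\<le>m div 2 - k. ?g k j)"
      unfolding b by (simp add: sum_distrib_left diff_diff_left algebra_simps)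
  qed
  also have "\<dots> = (\<Sum>(k, j)\<in>Sigma {..m div 2} (\<lambda>k. {..m div 2 - k}). ?g k j)"
    by (rule sum.Sigma) auto
  also have "Sigma {..m div 2} (\<lambda>k. {..m div 2 - k}) = {(k, j). k + j \<le> m div 2}"
    by auto
  also have "(\<Sum>(k, j)\<in>{(k, j). k + j \<le> m div 2}. ?g k j)
      = (\<Sum>N\<le>m div 2. \<Sum>k\<le>N. ?g k (N - k))"
    by (rule sum.triangle_reindex_eq)
  also have "\<dots> = (\<Sum>N\<le>m div 2. if N = 0 then a m else 0)"
  proof (rule sum.cong[OF refl])
    fix N assume "N \<in> {..m div 2}"
    then have N: "2 * N \<le> m" by auto
    have "(\<Sum>k\<le>N. ?g k (N - k))
        = a (m - 2 * N) * (\<Sum>k\<le>N. ?c k * (of_int (\<alpha> - int (m - 2 * N)) gchoose (N - k)))"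
      unfolding sum_distrib_left by (rule sum.cong) (auto simp: mult_ac)
    also have "\<dots> = a (m - 2 * N) * (if N = 0 then 1 else 0)"
      using N by (subst binom_diff_convolution) (auto simp: of_nat_diff)
    finally show "(\<Sum>k\<le>N. ?g k (N - k)) = (if N = 0 then a m else 0)" by simp
  qed
  also have "\<dots> = a m" by simp
  finally show ?thesis .
qed

section \<open>Generating functions of the symmetric functions\<close>

text \<open>The sign \<open>c\<close> allows one substitution lemma to serve both families: \<open>c = 1\<close> generates the
  elementary functions, and the inverse of the product with \<open>c = -1\<close> the complete ones.\<close>
definition linear_prod :: "complex \<Rightarrow> nat \<Rightarrow> (nat \<Rightarrow> complex) \<Rightarrow> complex fps" where
  "linear_prod c s w = (\<Prod>j=1..s. 1 + fps_const (c * w j) * fps_X)"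

lemma elem_sym_gf: "fps_nth (linear_prod 1 s w) n = elem_sym s n w"
proof -
  have const: "(\<Prod>j\<in>J. fps_const (w j)) = fps_const (\<Prod>j\<in>J. w j)" for J
    by (induction J rule: infinite_finite_induct) auto
  have "linear_prod 1 s w = (\<Prod>j=1..s. fps_const (w j) * fps_X + 1)"
    by (simp add: linear_prod_def add.commute)
  also have "\<dots> = (\<Sum>J\<in>Pow {1..s}. \<Prod>j\<in>J. fps_const (w j) * fps_X)"
    by (subst prod_add) simp_all
  also have "\<dots> = (\<Sum>J\<in>Pow {1..s}. fps_const (\<Prod>j\<in>J. w j) * fps_X ^ card J)"
    by (simp add: prod.distrib const)
  also have "fps_nth \<dots> n = (\<Sum>J\<in>Pow {1..s}. if card J = n then \<Prod>j\<in>J. w j else 0)"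
    by (auto simp: fps_sum_nth intro!: sum.cong)
  also have "\<dots> = elem_sym s n w"
    unfolding elem_sym_def by (subst sum.inter_filter[symmetric]) (auto intro!: sum.cong)
  finally show ?thesis .
qed

lemma complete_sym_0: "complete_sym 0 n w = (if n = 0 then 1 else 0)"
  by (simp add: complete_sym_def)

text \<open>The sum is split according to the exponent \<open>n - i\<close> of the last variable.\<close>
lemma complete_sym_Suc:
  "complete_sym (Suc s) n w = (\<Sum>i=0..n. complete_sym s i w * w (Suc s) ^ (n - i))"
proof -
  let ?S = "\<lambda>s n. {a. a \<in> {1..s} \<rightarrow>\<^sub>E (UNIV :: nat set) \<and> (\<Sum>i=1..s. a i) = n}"
  have fin: "finite (?S s n)" for n
  proof (rule finite_subset)
    show "?S s n \<subseteq> {1..s} \<rightarrow>\<^sub>E {..n}"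
    proof
      fix a assume a: "a \<in> ?S s n"
      have "a i \<le> n" if "i \<in> {1..s}" for i
        using member_le_sum[of i "{1..s}" a] a that by auto
      then show "a \<in> {1..s} \<rightarrow>\<^sub>E {..n}" using a by (auto simp: PiE_iff)
    qed
  qed (simp add: finite_PiE)
  have "(\<Sum>i=0..n. complete_sym s i w * w (Suc s) ^ (n - i))
      = (\<Sum>(i, a)\<in>Sigma {0..n} (?S s). (\<Prod>j=1..s. w j ^ a j) * w (Suc s) ^ (n - i))"
    unfolding complete_sym_def sum_distrib_right by (subst sum.Sigma) (use fin in auto)
  also have "\<dots> = (\<Sum>a\<in>?S (Suc s) n. \<Prod>j=1..Suc s. w j ^ a j)"
    \<comment> \<open>Removing the last exponent must restore \<open>undefined\<close>, since tuples are extensional.\<close>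
  proof (rule sum.reindex_bij_witness
      [where i = "\<lambda>a. (n - a (Suc s), a(Suc s := undefined))"
         and j = "\<lambda>(i, a). a(Suc s := n - i)"]; (clarify; (intro conjI)?)?)
  qed (auto simp: PiE_iff extensional_def fun_eq_iff)
  finally show ?thesis by (simp add: complete_sym_def)
qed

lemma geometric_fps: "inverse (1 + fps_const (- c) * fps_X) = Abs_fps (\<lambda>n. (c :: complex) ^ n)"
proof (rule fps_inverse_unique)
  show "(1 + fps_const (- c) * fps_X) * Abs_fps (\<lambda>n. c ^ n) = 1"
    by (rule fps_ext) (auto simp: distrib_right mult.assoc power_eq_if)
qed

lemma complete_sym_gf: "fps_nth (inverse (linear_prod (- 1) s w)) n = complete_sym s n w"
proof (induction s arbitrary: n)
  case 0
  then show ?case by (simp add: linear_prod_def complete_sym_0)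
next
  case (Suc s)
  have "inverse (linear_prod (- 1) (Suc s) w)
      = inverse (linear_prod (- 1) s w) * Abs_fps (\<lambda>n. w (Suc s) ^ n)"
    by (simp add: linear_prod_def fps_inverse_mult geometric_fps[symmetric])
  then show ?case by (simp add: fps_mult_nth Suc complete_sym_Suc)
qed

lemma linear_prod_append_inverse:
  assumes "\<forall>j\<in>{1..r}. z j \<noteq> 0"
  shows "linear_prod c (2 * r) (append_inverse r z)
       = (\<Prod>j=1..r. 1 + fps_const (c * plus_inverse z j) * fps_X + fps_const (c\<^sup>2) * fps_X ^ 2)"
proof -
  let ?f = "\<lambda>x. 1 + fps_const (c * x) * fps_X"
  have "linear_prod c (2 * r) (append_inverse r z)
      = (\<Prod>j\<in>{1..r} \<union> {r+1..2*r}. ?f (append_inverse r z j))"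
    unfolding linear_prod_def by (rule prod.cong) auto
  also have "\<dots> = (\<Prod>j=1..r. ?f (z j)) * (\<Prod>j=r+1..2*r. ?f (inverse (z (j - r))))"
    by (subst prod.union_disjoint) (auto simp: append_inverse_def intro!: arg_cong2[where f = "(*)"] prod.cong)
  also have "(\<Prod>j=r+1..2*r. ?f (inverse (z (j - r)))) = (\<Prod>j=1..r. ?f (inverse (z j)))"
    by (rule prod.reindex_bij_witness[where i = "\<lambda>j. j + r" and j = "\<lambda>j. j - r"]) auto
  also have "(\<Prod>j=1..r. ?f (z j)) * (\<Prod>j=1..r. ?f (inverse (z j)))
      = (\<Prod>j=1..r. ?f (z j) * ?f (inverse (z j)))"
    by (simp add: prod.distrib)
  also have "\<dots> = (\<Prod>j=1..r. 1 + fps_const (c * plus_inverse z j) * fps_X + fps_const (c\<^sup>2) * fps_X ^ 2)"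
  proof (rule prod.cong[OF refl])
    fix j assume "j \<in> {1..r}"
    then have "c * z j * (c * inverse (z j)) = c\<^sup>2" using assms by (auto simp: power2_eq_square)
    then have *: "fps_const (c * z j) * fps_const (c * inverse (z j)) = fps_const (c\<^sup>2)" by simp
    have "?f (z j) * ?f (inverse (z j)) = 1 + (fps_const (c * z j) + fps_const (c * inverse (z j))) * fps_X
        + fps_const (c * z j) * fps_const (c * inverse (z j)) * fps_X ^ 2"
      by (simp add: algebra_simps power2_eq_square del: fps_const_mult fps_const_add)
    then show "?f (z j) * ?f (inverse (z j))
       = 1 + fps_const (c * plus_inverse z j) * fps_X + fps_const (c\<^sup>2) * fps_X ^ 2"
      unfolding * by (simp add: plus_inverse_def distrib_left)
  qed
  finally show ?thesis .
qed

section \<open>The substitution \<open>t / (1 + t\<^sup>2)\<close>\<close>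

text \<open>This is \<open>(1 + t\<^sup>2)\<^sup>\<alpha>\<close>, for arbitrary \<open>\<alpha>\<close> because the exponents \<open>\<alpha> - l\<close> that occur
  can have either sign.\<close>
definition quad_powr :: "complex \<Rightarrow> complex fps" where
  "quad_powr \<alpha> = fps_binomial \<alpha> oo fps_X ^ 2"

lemma quad_powr_add: "quad_powr (\<alpha> + \<beta>) = quad_powr \<alpha> * quad_powr \<beta>"
  unfolding quad_powr_def fps_binomial_add_mult by (rule fps_compose_mult_distrib) simp

lemma quad_powr_0: "quad_powr 0 = 1" by (simp add: quad_powr_def)
lemma quad_powr_1: "quad_powr 1 = 1 + fps_X ^ 2" by (simp add: quad_powr_def fps_binomial_1 fps_compose_add_distrib)

lemma quad_powr_power: "quad_powr \<alpha> ^ n = quad_powr (of_nat n * \<alpha>)"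
  by (induction n) (simp_all add: quad_powr_0 distrib_right quad_powr_add)

lemma quad_powr_inverse: "inverse (quad_powr \<alpha>) = quad_powr (- \<alpha>)"
  by (rule fps_inverse_unique) (simp add: quad_powr_add[symmetric] quad_powr_0)

lemma quad_powr_nth: "fps_nth (quad_powr \<alpha>) n = (if even n then \<alpha> gchoose (n div 2) else 0)"
proof -
  have "fps_nth (quad_powr \<alpha>) n = (\<Sum>i=0..n. if i = n div 2 then if even n then \<alpha> gchoose i else 0 else 0)"
    unfolding quad_powr_def fps_compose_nth by (rule sum.cong) (auto simp: power_mult[symmetric])
  then show ?thesis by simp
qed

text \<open>The reciprocal \<open>t / (1 + t\<^sup>2)\<close> of the Joukowski map \<open>t + 1/t\<close>, which has no constant term
  and can therefore be substituted into a formal power series.\<close>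
definition joukowski :: "complex fps" where "joukowski = fps_X * quad_powr (- 1)"

lemma joukowski_quad_powr: "joukowski * quad_powr 1 = fps_X"
  by (simp add: joukowski_def mult.assoc quad_powr_add[symmetric] quad_powr_0)

text \<open>Each quadratic factor is \<open>1 + c w t + t\<^sup>2 = (1 + t\<^sup>2) (1 + c w y)\<close> with \<open>y = t / (1 + t\<^sup>2)\<close>.\<close>
lemma linear_prod_joukowski:
  assumes "\<forall>j\<in>{1..r}. z j \<noteq> 0" "c\<^sup>2 = 1"
  shows "linear_prod c (2 * r) (append_inverse r z)
       = (linear_prod c r (plus_inverse z) oo joukowski) * quad_powr (of_nat r)"
proof -
  have joukowski_0: "fps_nth joukowski 0 = 0" by (simp add: joukowski_def)
  have *: "(1 + fps_const (c * x) * joukowski) * quad_powr 1 = 1 + fps_const (c * x) * fps_X + fps_const (c\<^sup>2) * fps_X ^ 2" for x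
    using assms(2) by (simp add: distrib_right mult.assoc joukowski_quad_powr) (simp add: quad_powr_1)
  have "linear_prod c r (plus_inverse z) oo joukowski = (\<Prod>j=1..r. 1 + fps_const (c * plus_inverse z j) * joukowski)"
    using joukowski_0 unfolding linear_prod_def
    by (simp add: fps_compose_prod_distrib fps_compose_add_distrib fps_compose_mult_distrib)
  also have "\<dots> * quad_powr (of_nat r) = (\<Prod>j=1..r. (1 + fps_const (c * plus_inverse z j) * joukowski) * quad_powr 1)"
    by (simp add: prod.distrib quad_powr_power)
  finally show ?thesis
    unfolding linear_prod_append_inverse[OF assms(1)] * by simp
qed

text \<open>The summand \<open>a\<^sub>i y\<^sup>i (1 + t\<^sup>2)\<^sup>\<alpha>\<close> equals \<open>a\<^sub>i t\<^sup>i (1 + t\<^sup>2)\<^bsup>\<alpha> - i\<^esup>\<close>; it contributes to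
  the coefficient of \<open>t\<^sup>n\<close> only if \<open>n - i = 2 j\<close>, and then by the \<open>j\<close>-th binomial coefficient.\<close>
lemma joukowski_subst_nth:
  "fps_nth ((A oo joukowski) * quad_powr \<alpha>) n
     = (\<Sum>j\<le>n div 2. fps_nth A (n - 2 * j) * ((\<alpha> - of_nat (n - 2 * j)) gchoose j))"
proof -
  have joukowski_0: "fps_nth joukowski 0 = 0" by (simp add: joukowski_def)
  have joukowski_power: "joukowski ^ i * quad_powr \<alpha> = fps_X ^ i * quad_powr (\<alpha> - of_nat i)" for i
  proof -
    have "quad_powr (\<alpha> - of_nat i) = quad_powr (- of_nat i) * quad_powr \<alpha>" by (simp add: quad_powr_add[symmetric])
    then show ?thesis by (simp add: joukowski_def power_mult_distrib quad_powr_power mult.assoc)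
  qed
  \<comment> \<open>Extending the inner sums from \<open>i \<le> k\<close> to \<open>i \<le> n\<close> adds only zeros, as \<open>y\<^sup>i\<close> has order \<open>i\<close>; this
    makes the two summations interchangeable.\<close>
  have "fps_nth ((A oo joukowski) * quad_powr \<alpha>) n
      = (\<Sum>k=0..n. (\<Sum>i=0..n. fps_nth A i * fps_nth (joukowski ^ i) k) * fps_nth (quad_powr \<alpha>) (n - k))"
    unfolding fps_mult_nth fps_compose_nth
    by (intro sum.cong refl arg_cong2[where f = "(*)"] sum.mono_neutral_left)
       (auto simp: startsby_zero_power_prefix[OF joukowski_0])
  also have "\<dots> = (\<Sum>i=0..n. fps_nth A i * fps_nth (joukowski ^ i * quad_powr \<alpha>) n)"
    unfolding fps_mult_nth sum_distrib_left sum_distrib_right mult.assoc by (rule sum.swap)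
  also have "\<dots> = (\<Sum>i=0..n. if even (n - i) then fps_nth A i * ((\<alpha> - of_nat i) gchoose ((n - i) div 2)) else 0)"
    unfolding joukowski_power by (rule sum.cong) (auto simp: fps_X_power_mult_nth quad_powr_nth)
  also have "\<dots> = (\<Sum>i\<in>{i\<in>{0..n}. even (n - i)}. fps_nth A i * ((\<alpha> - of_nat i) gchoose ((n - i) div 2)))"
    by (rule sum.inter_filter[symmetric]) simp
  also have "\<dots> = (\<Sum>j\<le>n div 2. fps_nth A (n - 2 * j) * ((\<alpha> - of_nat (n - 2 * j)) gchoose j))"
    by (rule sum.reindex_bij_witness[where i = "\<lambda>j. n - 2 * j" and j = "\<lambda>i. (n - i) div 2"])
       (auto simp del: of_nat_diff)
  finally show ?thesis .
qed

section \<open>Symmetric functions of a tuple and its inverses\<close>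

lemma elem_sym_append_inverse:
  assumes "\<forall>j\<in>{1..r}. z j \<noteq> 0"
  shows "elem_sym (2 * r) n (append_inverse r z)
    = (\<Sum>j\<le>n div 2. elem_sym r (n - 2 * j) (plus_inverse z) * (of_int (int r - int (n - 2 * j)) gchoose j))"
  unfolding elem_sym_gf[symmetric] linear_prod_joukowski[OF assms, of 1, simplified] joukowski_subst_nth by simp

lemma complete_sym_append_inverse:
  assumes "\<forall>j\<in>{1..r}. z j \<noteq> 0"
  shows "complete_sym (2 * r) n (append_inverse r z)
    = (\<Sum>j\<le>n div 2. complete_sym r (n - 2 * j) (plus_inverse z) * (of_int (- int r - int (n - 2 * j)) gchoose j))"
proof -
  have joukowski_0: "fps_nth joukowski 0 = 0" by (simp add: joukowski_def)
  have D0: "fps_nth (linear_prod c s w) 0 = 1" for c s w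
    unfolding linear_prod_def by (induction s) simp_all
  have "inverse (linear_prod (- 1) (2 * r) (append_inverse r z))
      = (inverse (linear_prod (- 1) r (plus_inverse z)) oo joukowski) * quad_powr (- of_nat r)"
    by (simp add: linear_prod_joukowski[OF assms] fps_inverse_mult quad_powr_inverse fps_inverse_compose[OF joukowski_0] D0)
  then show ?thesis
    unfolding complete_sym_gf[symmetric] by (simp add: joukowski_subst_nth)
qed

lemma elem_sym_eq_0:
  assumes "n > s"
  shows "elem_sym s n w = 0"
proof -
  have "card J \<le> s" if "J \<subseteq> {1..s}" for J
    using card_mono[OF _ that] by simp
  then have "{J. J \<subseteq> {1..s} \<and> card J = n} = {}"
    using assms by (auto simp: not_le[symmetric])
  then show ?thesis by (simp only: elem_sym_def sum.empty)
qed

lemma power_sum_append_inverse: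
  "power_sum (2 * r) n (append_inverse r z) = (\<Sum>j=1..r. z j ^ n + inverse (z j) ^ n)"
proof -
  have "power_sum (2 * r) n (append_inverse r z)
      = (\<Sum>j\<in>{1..r} \<union> {r+1..2*r}. append_inverse r z j ^ n)"
    unfolding power_sum_def by (rule sum.cong) auto
  also have "\<dots> = (\<Sum>j=1..r. z j ^ n) + (\<Sum>j=r+1..2*r. inverse (z (j - r)) ^ n)"
    by (subst sum.union_disjoint) (auto simp: append_inverse_def intro!: arg_cong2[where f = "(+)"] sum.cong)
  also have "(\<Sum>j=r+1..2*r. inverse (z (j - r)) ^ n) = (\<Sum>j=1..r. inverse (z j) ^ n)"
    by (rule sum.reindex_bij_witness[where i = "\<lambda>j. j + r" and j = "\<lambda>j. j - r"]) auto
  finally show ?thesis by (simp add: sum.distrib)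
qed

text \<open>The \<open>k\<close>-th terms of the expansions of \<open>(x + 1/x)\<^sup>m\<close> and \<open>(1/x + x)\<^sup>m\<close> add up to
  \<open>x\<^sup>d + x\<^sup>-\<^sup>d\<close> times \<open>binom(m, k)\<close>, where \<open>d = m - 2k\<close>; this depends on \<open>d\<close> only through
  \<open>\<bar>d\<bar>\<close>.\<close>
lemma plus_inverse_power:
  fixes x :: complex
  assumes "x \<noteq> 0"
  shows "2 * (x + inverse x) ^ m = (\<Sum>k=0..m. of_nat (m choose k) *
     (x ^ nat \<bar>int m - 2 * int k\<bar> + inverse x ^ nat \<bar>int m - 2 * int k\<bar>))"
proof -
  have "2 * (x + inverse x) ^ m = (x + inverse x) ^ m + (inverse x + x) ^ m"
    by (simp add: add.commute)
  also have "\<dots> = (\<Sum>k=0..m. of_nat (m choose k) * (x ^ k * inverse x ^ (m - k) + inverse x ^ k * x ^ (m - k)))"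
    unfolding binomial_ring by (simp add: sum.distrib[symmetric] distrib_left mult.assoc atLeast0AtMost)
  also have "\<dots> = (\<Sum>k=0..m. of_nat (m choose k) *
     (x ^ nat \<bar>int m - 2 * int k\<bar> + inverse x ^ nat \<bar>int m - 2 * int k\<bar>))"
  proof (intro sum.cong refl arg_cong2[where f = "(*)"])
    fix k assume "k \<in> {0..m}"
    have cancel: "x ^ a * inverse x ^ (a + d) = inverse x ^ d"
      "inverse x ^ a * x ^ (a + d) = x ^ d"
      "x ^ (a + d) * inverse x ^ a = x ^ d"
      "inverse x ^ (a + d) * x ^ a = inverse x ^ d" for a d
      using assms by (simp_all add: power_add field_simps)
    show "x ^ k * inverse x ^ (m - k) + inverse x ^ k * x ^ (m - k)
      = x ^ nat \<bar>int m - 2 * int k\<bar> + inverse x ^ nat \<bar>int m - 2 * int k\<bar>"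
    proof (cases "2 * k \<le> m")
      case True
      define d where "d = m - 2 * k"
      then have "m - k = k + d" "nat \<bar>int m - 2 * int k\<bar> = d" using True by auto
      then show ?thesis by (simp add: cancel)
    next
      case False
      define d where "d = 2 * k - m"
      then have "k = (m - k) + d" "nat \<bar>int m - 2 * int k\<bar> = d" using False \<open>k \<in> {0..m}\<close> by auto
      then show ?thesis by (metis cancel(3,4))
    qed
  qed
  finally show ?thesis .
qed

theorem theorem1:
  fixes r m :: nat and z :: "nat \<Rightarrow> complex"
  assumes "r \<ge> 1"
    and "\<forall>j\<in>{1..r}. z j \<noteq> 0"
  shows "(\<Sum>k = nat (max (int (m div 2) - int r) 0)..m div 2.
            binom_diff (int m - int r - 1) (int k) * elem_sym (2 * r) (m - 2 * k) (append_inverse r z))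
          = (if m \<le> r then elem_sym r m (plus_inverse z) else 0)
       \<and> complete_sym r m (plus_inverse z)
          = (\<Sum>k = 0..m div 2.
              binom_diff (int m + int r - 1) (int k) * complete_sym (2 * r) (m - 2 * k) (append_inverse r z))
       \<and> power_sum r m (plus_inverse z)
          = 1 / 2 * (\<Sum>k = 0..m.
              binom (int m) (int k) * power_sum (2 * r) (nat \<bar>int m - 2 * int k\<bar>) (append_inverse r z))"
proof (intro conjI)
  \<comment> \<open>The omitted terms \<open>k < m div 2 - r\<close> have \<open>m - 2 k > 2 r\<close>, where the elementary functions vanish.\<close>
  have "(\<Sum>k = nat (max (int (m div 2) - int r) 0)..m div 2.
            binom_diff (int m - int r - 1) (int k) * elem_sym (2 * r) (m - 2 * k) (append_inverse r z))
     = (\<Sum>k\<le>m div 2.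
            binom_diff (int m - int r - 1) (int k) * elem_sym (2 * r) (m - 2 * k) (append_inverse r z))"
    by (rule sum.mono_neutral_left) (auto intro!: elem_sym_eq_0)
  also have "\<dots> = elem_sym r m (plus_inverse z)"
    by (rule binom_diff_inversion) (rule elem_sym_append_inverse[OF assms(2)])
  finally show "(\<Sum>k = nat (max (int (m div 2) - int r) 0)..m div 2.
            binom_diff (int m - int r - 1) (int k) * elem_sym (2 * r) (m - 2 * k) (append_inverse r z))
          = (if m \<le> r then elem_sym r m (plus_inverse z) else 0)"
    by (simp add: elem_sym_eq_0)
next
  show "complete_sym r m (plus_inverse z)
          = (\<Sum>k = 0..m div 2.
              binom_diff (int m + int r - 1) (int k) * complete_sym (2 * r) (m - 2 * k) (append_inverse r z))"
    using binom_diff_inversion[OF complete_sym_append_inverse[OF assms(2)], of m]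
    by (simp add: atLeast0AtMost)
next
  have "2 * power_sum r m (plus_inverse z) = (\<Sum>j=1..r. \<Sum>k=0..m. of_nat (m choose k) *
     (z j ^ nat \<bar>int m - 2 * int k\<bar> + inverse (z j) ^ nat \<bar>int m - 2 * int k\<bar>))"
    unfolding power_sum_def sum_distrib_left plus_inverse_def
    by (intro sum.cong refl plus_inverse_power) (use assms(2) in auto)
  also have "\<dots> = (\<Sum>k = 0..m.
              binom (int m) (int k) * power_sum (2 * r) (nat \<bar>int m - 2 * int k\<bar>) (append_inverse r z))"
    unfolding power_sum_append_inverse
    by (subst sum.swap) (simp add: sum_distrib_left binom_def binomial_gbinomial)
  finally show "power_sum r m (plus_inverse z)
          = 1 / 2 * (\<Sum>k = 0..m.
              binom (int m) (int k) * power_sum (2 * r) (nat \<bar>int m - 2 * int k\<bar>) (append_inverse r z))"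
    by (simp add: mult.commute)
qed

end
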